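(* Let $\Omega\subset\mathbb{R}^4$ be a smooth, oriented bounded domain and let $\lambda_1(\Omega)$ be the first eigenvalue of the bi-Laplacian $\Delta^2$ on $\Omega$. Suppose that for every $\alpha$ with $0\le\alpha<\lambda_1(\Omega)$, $$\sup_{u\in H_0^2(\Omega),\ \|u\|_{2,\alpha}\le 1}\ \int_\Omega e^{32\pi^2u^2}\,dx<\infty .$$ Then for every integer $k\ge 1$ and all real numbers $a_1,\dots,a_k$ with $0\le a_1<\lambda_1(\Omega)$ and $0\le a_{i}\le\lambda_1(\Omega)\,a_{i-1}$ for $2\le i\le k$, setting $q(t)=1+a_1t+\cdots+a_kt^k$, one has $$\sup_{u\in H_0^2(\Omega),\ \|\Delta u\|_2\le 1}\ \int_\Omega e^{32\pi^2 q(\|u\|_2^2)\,u^2}\,dx<\infty .$$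
   Context: $\|\cdot\|_2$ is the $L^2(\Omega)$ norm. $H_0^2(\Omega)$ is the completion of $C_0^\infty(\Omega)$ under the norm $\|\Delta u\|_2$. $\lambda_1(\Omega)=\inf\{\|\Delta u\|_2^2/\|u\|_2^2 : u\in H_0^2(\Omega),\ u\not\equiv 0\}>0$. For $0\le\alpha<\lambda_1(\Omega)$ and $u\in H_0^2(\Omega)$, $\|u\|_{2,\alpha}^2=\|\Delta u\|_2^2-\alpha\|u\|_2^2$; this defines a norm on $H_0^2(\Omega)$ equivalent to $\|\Delta u\|_2$. *)

theory Defs
  imports "HOL-Analysis.Analysis"
begin

definition partial_deriv :: "'n::finite \<Rightarrow> (real^'n \<Rightarrow> real) \<Rightarrow> real^'n \<Rightarrow> real" where
  "partial_deriv i f x = frechet_derivative f (at x) (axis i 1)"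

definition laplacian :: "(real^'n::finite \<Rightarrow> real) \<Rightarrow> real^'n \<Rightarrow> real" where
  "laplacian f x = (\<Sum>i\<in>UNIV. partial_deriv i (partial_deriv i f) x)"

fun C_k :: "nat \<Rightarrow> (real^'n::finite \<Rightarrow> real) \<Rightarrow> bool" where
  "C_k 0 f \<longleftrightarrow> continuous_on UNIV f"
| "C_k (Suc k) f \<longleftrightarrow> f differentiable_on UNIV \<and> (\<forall>i. C_k k (partial_deriv i f))"

definition smooth :: "(real^'n::finite \<Rightarrow> real) \<Rightarrow> bool" where
  "smooth f \<longleftrightarrow> (\<forall>k. C_k k f)"

text \<open>Near each boundary point the domain is the strict sublevel set of a smooth function
  with nonvanishing gradient. The defining function may be taken globally smooth
  (multiply by a cutoff and shrink \<open>U\<close>). An open subset of \<open>\<real>\<^sup>n\<close> carries the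
  standard orientation, so orientability imposes no further condition.\<close>

definition smooth_boundary :: "(real^'n::finite) set \<Rightarrow> bool" where
  "smooth_boundary \<Omega> \<longleftrightarrow>
     (\<forall>p\<in>frontier \<Omega>. \<exists>U \<rho>. open U \<and> p \<in> U \<and> smooth \<rho> \<and> (\<exists>i. partial_deriv i \<rho> p \<noteq> 0) \<and>
        \<Omega> \<inter> U = {x\<in>U. \<rho> x < 0} \<and> frontier \<Omega> \<inter> U = {x\<in>U. \<rho> x = 0})"

definition smooth_bounded_domain :: "(real^'n::finite) set \<Rightarrow> bool" where
  "smooth_bounded_domain \<Omega> \<longleftrightarrow>
     open \<Omega> \<and> connected \<Omega> \<and> \<Omega> \<noteq> {} \<and> bounded \<Omega> \<and> smooth_boundary \<Omega>"

definition test_functions :: "(real^'n::finite) set \<Rightarrow> (real^'n \<Rightarrow> real) set" where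
  "test_functions \<Omega> =
     {\<phi>. smooth \<phi> \<and> compact (closure {x. \<phi> x \<noteq> 0}) \<and> closure {x. \<phi> x \<noteq> 0} \<subseteq> \<Omega>}"

text \<open>Elements of \<open>L\<^sup>2(\<Omega>)\<close> are represented by functions on the whole space; only their values
  almost everywhere on \<open>\<Omega>\<close> matter.\<close>

definition L2 :: "(real^'n::finite) set \<Rightarrow> (real^'n \<Rightarrow> real) set" where
  "L2 \<Omega> = {u \<in> borel_measurable (lebesgue_on \<Omega>). integrable (lebesgue_on \<Omega>) (\<lambda>x. (u x)\<^sup>2)}"

definition L2_norm :: "(real^'n::finite) set \<Rightarrow> (real^'n \<Rightarrow> real) \<Rightarrow> real" where
  "L2_norm \<Omega> u = sqrt (\<integral>x. (u x)\<^sup>2 \<partial>lebesgue_on \<Omega>)"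

text \<open>A sequence of test functions that is Cauchy for \<open>\<parallel>\<Delta>\<cdot>\<parallel>\<^sub>2\<close> represents an element of the
  completion. On a bounded domain \<open>\<parallel>\<phi>\<parallel>\<^sub>2 \<le> C \<parallel>\<Delta>\<phi>\<parallel>\<^sub>2\<close> for test functions, so such a sequence
  converges in \<open>L\<^sup>2(\<Omega>)\<close>; the element is identified with this limit \<open>u\<close>.\<close>

definition H02_approx :: "(real^'n::finite) set \<Rightarrow> (nat \<Rightarrow> real^'n \<Rightarrow> real) \<Rightarrow> (real^'n \<Rightarrow> real) \<Rightarrow> bool" where
  "H02_approx \<Omega> \<phi> u \<longleftrightarrow>
     (\<forall>n. \<phi> n \<in> test_functions \<Omega>) \<and>
     (\<forall>e>0. \<exists>N. \<forall>m\<ge>N. \<forall>n\<ge>N. L2_norm \<Omega> (laplacian (\<lambda>x. \<phi> m x - \<phi> n x)) < e) \<and>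
     (\<lambda>n. L2_norm \<Omega> (\<lambda>x. \<phi> n x - u x)) \<longlonglongrightarrow> 0"

definition H02 :: "(real^'n::finite) set \<Rightarrow> (real^'n \<Rightarrow> real) set" where
  "H02 \<Omega> = {u \<in> L2 \<Omega>. \<exists>\<phi>. H02_approx \<Omega> \<phi> u}"

text \<open>The extension of \<open>\<Delta>\<close> by continuity from test functions to \<open>H02 \<Omega>\<close>: the \<open>L\<^sup>2\<close> limit of
  \<open>\<Delta>\<phi>\<^sub>n\<close>, determined up to null sets. It is also the weak Laplacian of \<open>u\<close>.\<close>

definition H02_laplacian :: "(real^'n::finite) set \<Rightarrow> (real^'n \<Rightarrow> real) \<Rightarrow> real^'n \<Rightarrow> real" where
  "H02_laplacian \<Omega> u =
     (SOME w. w \<in> L2 \<Omega> \<and>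
        (\<exists>\<phi>. H02_approx \<Omega> \<phi> u \<and> (\<lambda>n. L2_norm \<Omega> (\<lambda>x. laplacian (\<phi> n) x - w x)) \<longlonglongrightarrow> 0))"

definition H02_norm :: "(real^'n::finite) set \<Rightarrow> (real^'n \<Rightarrow> real) \<Rightarrow> real" where
  "H02_norm \<Omega> u = L2_norm \<Omega> (H02_laplacian \<Omega> u)"

definition lambda1 :: "(real^'n::finite) set \<Rightarrow> real" where
  "lambda1 \<Omega> = (INF u\<in>{u \<in> H02 \<Omega>. \<not> (AE x in lebesgue_on \<Omega>. u x = 0)}.
     (H02_norm \<Omega> u)\<^sup>2 / (L2_norm \<Omega> u)\<^sup>2)"

definition H02_norm_alpha :: "(real^'n::finite) set \<Rightarrow> real \<Rightarrow> (real^'n \<Rightarrow> real) \<Rightarrow> real" where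
  "H02_norm_alpha \<Omega> \<alpha> u = sqrt ((H02_norm \<Omega> u)\<^sup>2 - \<alpha> * (L2_norm \<Omega> u)\<^sup>2)"

end

theory Submission
  imports Defs
begin

text \<open>Write \<open>t = \<parallel>u\<parallel>\<^sub>2\<^sup>2\<close>, so \<open>\<lambda>\<^sub>1 t \<le> 1\<close> when \<open>\<parallel>\<Delta>u\<parallel>\<^sub>2 \<le> 1\<close>. The coefficient conditions yield
  some \<open>\<alpha> < \<lambda>\<^sub>1\<close> with \<open>q t (1 - \<alpha> t) \<le> 1\<close> for all such \<open>t\<close>, so \<open>v = sqrt (q t) u\<close> satisfies
  \<open>\<parallel>v\<parallel>\<^bsub>2,\<alpha>\<^esub> \<le> 1\<close> and the integral for \<open>u\<close> is the one bounded by hypothesis for \<open>v\<close>.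
  The homogeneity of \<open>\<parallel>\<Delta>\<cdot>\<parallel>\<^sub>2\<close> used here rests on the uniqueness of the \<open>L\<^sup>2\<close> extension of the
  Laplacian, that is, on its closability.\<close>

section \<open>The \<open>L2\<close> seminorm: Cauchy-Schwarz and the triangle inequality\<close>

lemma L2_mult_integrable:
  assumes "f \<in> L2 \<Omega>" "g \<in> L2 \<Omega>"
  shows "integrable (lebesgue_on \<Omega>) (\<lambda>x. f x * g x)"
proof (rule Bochner_Integration.integrable_bound)
  show "integrable (lebesgue_on \<Omega>) (\<lambda>x. (f x)\<^sup>2 + (g x)\<^sup>2)"
    using assms by (auto simp: L2_def)
  show "(\<lambda>x. f x * g x) \<in> borel_measurable (lebesgue_on \<Omega>)"
    using assms by (auto simp: L2_def)
  have "\<bar>f x * g x\<bar> \<le> (f x)\<^sup>2 + (g x)\<^sup>2" for x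
  proof -
    have "0 \<le> (\<bar>f x\<bar> - \<bar>g x\<bar>)\<^sup>2" by simp
    then have "2 * (\<bar>f x\<bar> * \<bar>g x\<bar>) \<le> (f x)\<^sup>2 + (g x)\<^sup>2"
      by (simp add: power2_diff)
    moreover have "0 \<le> \<bar>f x\<bar> * \<bar>g x\<bar>" by simp
    ultimately have "\<bar>f x\<bar> * \<bar>g x\<bar> \<le> (f x)\<^sup>2 + (g x)\<^sup>2" by linarith
    then show ?thesis by (simp add: abs_mult)
  qed
  then show "AE x in lebesgue_on \<Omega>. norm (f x * g x) \<le> norm ((f x)\<^sup>2 + (g x)\<^sup>2)"
    by auto
qed

lemma L2_lincomb:
  assumes "f \<in> L2 \<Omega>" "g \<in> L2 \<Omega>"
  shows "(\<lambda>x. a * f x + b * g x) \<in> L2 \<Omega>"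
proof -
  have "(\<lambda>x. (a * f x + b * g x)\<^sup>2)
      = (\<lambda>x. a\<^sup>2 * (f x)\<^sup>2 + 2 * a * b * (f x * g x) + b\<^sup>2 * (g x)\<^sup>2)"
    by (auto simp: power2_eq_square algebra_simps)
  moreover have "integrable (lebesgue_on \<Omega>) \<dots>"
    using assms L2_mult_integrable[OF assms]
    by (intro Bochner_Integration.integrable_add integrable_mult_right) (auto simp: L2_def)
  ultimately show ?thesis using assms by (auto simp: L2_def)
qed

lemma L2_scale: "f \<in> L2 \<Omega> \<Longrightarrow> (\<lambda>x. a * f x) \<in> L2 \<Omega>"
  using L2_lincomb[of f \<Omega> f a 0] by simp

lemma L2_diff: "f \<in> L2 \<Omega> \<Longrightarrow> g \<in> L2 \<Omega> \<Longrightarrow> (\<lambda>x. f x - g x) \<in> L2 \<Omega>"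
  using L2_lincomb[of f \<Omega> g 1 "-1"] by simp

lemma L2_norm_nonneg: "0 \<le> L2_norm \<Omega> f"
  by (simp add: L2_norm_def)

lemma L2_norm_power2: "(L2_norm \<Omega> f)\<^sup>2 = (\<integral>x. (f x)\<^sup>2 \<partial>lebesgue_on \<Omega>)"
  by (simp add: L2_norm_def)

lemma L2_norm_scale: "L2_norm \<Omega> (\<lambda>x. c * f x) = \<bar>c\<bar> * L2_norm \<Omega> f"
  by (simp add: L2_norm_def power_mult_distrib real_sqrt_mult)

lemma L2_norm_eq_0_AE:
  assumes "f \<in> L2 \<Omega>" "L2_norm \<Omega> f = 0"
  shows "AE x in lebesgue_on \<Omega>. f x = 0"
proof -
  have "integrable (lebesgue_on \<Omega>) (\<lambda>x. (f x)\<^sup>2)" using assms by (simp add: L2_def)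
  moreover have "(\<integral>x. (f x)\<^sup>2 \<partial>lebesgue_on \<Omega>) = 0"
    using assms(2) L2_norm_power2[of \<Omega> f] by simp
  ultimately have "AE x in lebesgue_on \<Omega>. (f x)\<^sup>2 = 0"
    by (subst (asm) integral_nonneg_eq_0_iff_AE) auto
  then show ?thesis by simp
qed

lemma L2_norm_cong_AE:
  assumes "f \<in> L2 \<Omega>" "g \<in> L2 \<Omega>" "AE x in lebesgue_on \<Omega>. f x = g x"
  shows "L2_norm \<Omega> f = L2_norm \<Omega> g"
  unfolding L2_norm_def
  by (rule arg_cong[where f = sqrt], rule integral_cong_AE) (use assms in \<open>auto simp: L2_def\<close>)

text \<open>The quadratic form \<open>s, r\<close> \<mapsto> \<integral> (s f + r g)^2 is
  nonnegative. At s = \<parallel>g\<parallel>, r = \<parallel>f\<parallel> or r =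
  -\<parallel>f\<parallel> it factors as 2 \<parallel>f\<parallel> \<parallel>g\<parallel>
  (\<parallel>f\<parallel> \<parallel>g\<parallel> + I) or 2 \<parallel>f\<parallel>
  \<parallel>g\<parallel> (\<parallel>f\<parallel> \<parallel>g\<parallel> - I), where I is the
  integral of f g. The first factor can be cancelled only if both norms are positive; otherwise f g
  vanishes almost everywhere.\<close>

lemma L2_Cauchy_Schwarz:
  assumes f: "f \<in> L2 \<Omega>" and g: "g \<in> L2 \<Omega>"
  shows "\<bar>\<integral>x. f x * g x \<partial>lebesgue_on \<Omega>\<bar> \<le> L2_norm \<Omega> f * L2_norm \<Omega> g"
proof -
  let ?M = "lebesgue_on \<Omega>" and ?F = "L2_norm \<Omega> f" and ?G = "L2_norm \<Omega> g"
  let ?I = "\<integral>x. f x * g x \<partial>?M"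
  have sq: "integrable ?M (\<lambda>x. (f x)\<^sup>2)" "integrable ?M (\<lambda>x. (g x)\<^sup>2)"
    using f g by (auto simp: L2_def)
  have quad: "0 \<le> s\<^sup>2 * ?F\<^sup>2 + 2 * s * r * ?I + r\<^sup>2 * ?G\<^sup>2" for s r
  proof -
    have "0 \<le> (\<integral>x. (s * f x + r * g x)\<^sup>2 \<partial>?M)" by simp
    also have "(\<lambda>x. (s * f x + r * g x)\<^sup>2)
        = (\<lambda>x. s\<^sup>2 * (f x)\<^sup>2 + (2 * s * r) * (f x * g x) + r\<^sup>2 * (g x)\<^sup>2)"
      by (auto simp: power2_eq_square algebra_simps)
    also have "(\<integral>x. s\<^sup>2 * (f x)\<^sup>2 + (2 * s * r) * (f x * g x) + r\<^sup>2 * (g x)\<^sup>2 \<partial>?M)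
        = s\<^sup>2 * ?F\<^sup>2 + 2 * s * r * ?I + r\<^sup>2 * ?G\<^sup>2"
      using sq L2_mult_integrable[OF f g] by (simp add: L2_norm_power2)
    finally show ?thesis .
  qed
  consider "?F = 0" | "?G = 0" | "?F > 0" "?G > 0"
    using L2_norm_nonneg[of \<Omega> f] L2_norm_nonneg[of \<Omega> g] by fastforce
  then show ?thesis
  proof cases
    case 1
    then have "AE x in ?M. f x * g x = 0" using L2_norm_eq_0_AE[OF f] by auto
    then have "?I = 0" by (rule integral_eq_zero_AE)
    then show ?thesis using 1 by simp
  next
    case 2
    then have "AE x in ?M. f x * g x = 0" using L2_norm_eq_0_AE[OF g] by auto
    then have "?I = 0" by (rule integral_eq_zero_AE)
    then show ?thesis using 2 by simp
  next
    case 3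
    then have pos: "0 < 2 * ?F * ?G" by simp
    have "0 \<le> (2 * ?F * ?G) * (?F * ?G + ?I)"
      using quad[of ?G ?F] by (simp add: power2_eq_square algebra_simps)
    then have a: "0 \<le> ?F * ?G + ?I" using pos by (metis mult_zero_right mult_le_cancel_left_pos)
    have "0 \<le> (2 * ?F * ?G) * (?F * ?G - ?I)"
      using quad[of ?G "- ?F"] by (simp add: power2_eq_square algebra_simps)
    then have b: "0 \<le> ?F * ?G - ?I" using pos by (metis mult_zero_right mult_le_cancel_left_pos)
    from a b show ?thesis by linarith
  qed
qed

lemma L2_norm_triangle_diff:
  assumes f: "f \<in> L2 \<Omega>" and g: "g \<in> L2 \<Omega>"
  shows "L2_norm \<Omega> (\<lambda>x. f x - g x) \<le> L2_norm \<Omega> f + L2_norm \<Omega> g"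
proof (rule power2_le_imp_le)
  have "(L2_norm \<Omega> (\<lambda>x. f x - g x))\<^sup>2
      = (\<integral>x. (f x)\<^sup>2 - 2 * (f x * g x) + (g x)\<^sup>2 \<partial>lebesgue_on \<Omega>)"
    by (simp add: L2_norm_power2 power2_diff algebra_simps)
  also have "\<dots> = (L2_norm \<Omega> f)\<^sup>2 - 2 * (\<integral>x. f x * g x \<partial>lebesgue_on \<Omega>) + (L2_norm \<Omega> g)\<^sup>2"
    using f g L2_mult_integrable[OF f g] by (simp add: L2_norm_power2 L2_def)
  also have "\<dots> \<le> (L2_norm \<Omega> f + L2_norm \<Omega> g)\<^sup>2"
    using L2_Cauchy_Schwarz[OF f g] by (simp add: power2_sum abs_le_iff)
  finally show "(L2_norm \<Omega> (\<lambda>x. f x - g x))\<^sup>2 \<le> (L2_norm \<Omega> f + L2_norm \<Omega> g)\<^sup>2" .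
qed (simp add: L2_norm_nonneg)

section \<open>Closure properties of smooth functions and test functions\<close>

lemma partial_deriv_lincomb:
  assumes "f differentiable_on UNIV" "g differentiable_on UNIV"
  shows "partial_deriv i (\<lambda>x. a * f x + b * g x)
    = (\<lambda>x. a * partial_deriv i f x + b * partial_deriv i g x)"
proof
  fix x
  have "(f has_derivative frechet_derivative f (at x)) (at x)"
       "(g has_derivative frechet_derivative g (at x)) (at x)"
    using assms by (auto simp: differentiable_on_def frechet_derivative_works)
  then have "((\<lambda>x. a * f x + b * g x) has_derivative
      (\<lambda>h. a * frechet_derivative f (at x) h + b * frechet_derivative g (at x) h)) (at x)"
    by (intro derivative_intros)
  from frechet_derivative_at[OF this, symmetric]
  show "partial_deriv i (\<lambda>x. a * f x + b * g x) x
      = a * partial_deriv i f x + b * partial_deriv i g x"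
    by (simp add: partial_deriv_def)
qed

lemma partial_deriv_mult:
  assumes "f differentiable_on UNIV" "g differentiable_on UNIV"
  shows "partial_deriv i (\<lambda>x. f x * g x)
    = (\<lambda>x. f x * partial_deriv i g x + partial_deriv i f x * g x)"
proof
  fix x
  have "(f has_derivative frechet_derivative f (at x)) (at x)"
       "(g has_derivative frechet_derivative g (at x)) (at x)"
    using assms by (auto simp: differentiable_on_def frechet_derivative_works)
  then have "((\<lambda>x. f x * g x) has_derivative
      (\<lambda>h. f x * frechet_derivative g (at x) h + frechet_derivative f (at x) h * g x)) (at x)"
    by (intro derivative_intros)
  from frechet_derivative_at[OF this, symmetric]
  show "partial_deriv i (\<lambda>x. f x * g x) x = f x * partial_deriv i g x + partial_deriv i f x * g x"
    by (simp add: partial_deriv_def)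
qed

lemma C_k_lincomb: "C_k k f \<Longrightarrow> C_k k g \<Longrightarrow> C_k k (\<lambda>x. a * f x + b * g x)"
proof (induction k arbitrary: f g)
  case 0
  then show ?case by (auto intro!: continuous_intros)
next
  case (Suc k)
  then show ?case
    by (auto simp: partial_deriv_lincomb intro!: derivative_intros)
qed

lemma smooth_lincomb: "smooth f \<Longrightarrow> smooth g \<Longrightarrow> smooth (\<lambda>x. a * f x + b * g x)"
  by (simp add: smooth_def C_k_lincomb)

lemma smooth_differentiable: "smooth f \<Longrightarrow> f differentiable_on UNIV"
  unfolding smooth_def using C_k.simps(2)[of 0 f] by blast

lemma smooth_continuous: "smooth f \<Longrightarrow> continuous_on UNIV f"
  by (rule differentiable_imp_continuous_on[OF smooth_differentiable])

lemma smooth_partial_deriv: "smooth f \<Longrightarrow> smooth (partial_deriv i f)"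
  unfolding smooth_def using C_k.simps(2) by blast

lemma test_functions_support_subset:
  assumes "\<phi> \<in> test_functions \<Omega>" "smooth \<psi>" "{x. \<psi> x \<noteq> 0} \<subseteq> closure {x. \<phi> x \<noteq> 0}"
  shows "\<psi> \<in> test_functions \<Omega>"
proof -
  have "closure {x. \<psi> x \<noteq> 0} \<subseteq> closure {x. \<phi> x \<noteq> 0}"
    using assms(3) by (simp add: closure_minimal)
  moreover from this have "compact (closure {x. \<psi> x \<noteq> 0})"
    using assms(1) compact_Int_closed[of "closure {x. \<phi> x \<noteq> 0}" "closure {x. \<psi> x \<noteq> 0}"]
    by (simp add: test_functions_def Int_absorb1)
  ultimately show ?thesis using assms by (auto simp: test_functions_def)
qed

lemma test_functions_lincomb:
  assumes "\<phi> \<in> test_functions \<Omega>" "\<psi> \<in> test_functions \<Omega>"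
  shows "(\<lambda>x. a * \<phi> x + b * \<psi> x) \<in> test_functions \<Omega>"
proof -
  let ?S = "closure {x. \<phi> x \<noteq> 0} \<union> closure {x. \<psi> x \<noteq> 0}"
  let ?T = "closure {x. a * \<phi> x + b * \<psi> x \<noteq> 0}"
  have S: "compact ?S" "?S \<subseteq> \<Omega>" using assms by (auto simp: test_functions_def)
  have "{x. a * \<phi> x + b * \<psi> x \<noteq> 0} \<subseteq> {x. \<phi> x \<noteq> 0} \<union> {x. \<psi> x \<noteq> 0}" by auto
  from closure_mono[OF this] have T: "?T \<subseteq> ?S" by (simp only: closure_Un)
  then have "compact ?T" using S(1) compact_Int_closed[of ?S ?T] by (simp add: Int_absorb1)
  moreover have "smooth (\<lambda>x. a * \<phi> x + b * \<psi> x)"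
    using assms by (auto simp: test_functions_def intro: smooth_lincomb)
  ultimately show ?thesis using T S by (auto simp: test_functions_def)
qed

lemma test_functions_partial_deriv:
  assumes "\<phi> \<in> test_functions \<Omega>"
  shows "partial_deriv i \<phi> \<in> test_functions \<Omega>"
proof (rule test_functions_support_subset[OF assms])
  show "smooth (partial_deriv i \<phi>)" using assms smooth_partial_deriv by (auto simp: test_functions_def)
  have "partial_deriv i \<phi> x = 0" if x: "x \<notin> closure {x. \<phi> x \<noteq> 0}" for x
  proof -
    \<comment> \<open>Off its closed support, an open set, \<open>\<phi>\<close> coincides with the
      zero function.\<close>
    have "(\<phi> has_derivative (\<lambda>h. 0)) (at x)"
      by (rule has_derivative_transform_within_open[of "\<lambda>x. 0" _ _ _ "- closure {x. \<phi> x \<noteq> 0}"])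
        (use x closure_subset[of "{x. \<phi> x \<noteq> 0}"] in auto)
    from frechet_derivative_at[OF this, symmetric] show ?thesis by (simp add: partial_deriv_def)
  qed
  then show "{x. partial_deriv i \<phi> x \<noteq> 0} \<subseteq> closure {x. \<phi> x \<noteq> 0}" by auto
qed

lemma test_functions_sum:
  assumes "finite I" "I \<noteq> {}" "\<And>i. i \<in> I \<Longrightarrow> f i \<in> test_functions \<Omega>"
  shows "(\<lambda>x. \<Sum>i\<in>I. f i x) \<in> test_functions \<Omega>"
  using assms
proof (induction rule: finite_ne_induct)
  case (singleton i)
  then show ?case by (simp add: eta_contract_eq)
next
  case (insert i I)
  then show ?case
    using test_functions_lincomb[of "f i" \<Omega> "\<lambda>x. \<Sum>i\<in>I. f i x" 1 1] by simp
qed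

lemma test_functions_laplacian: "\<phi> \<in> test_functions \<Omega> \<Longrightarrow> laplacian \<phi> \<in> test_functions \<Omega>"
  unfolding laplacian_def[abs_def]
  by (intro test_functions_sum test_functions_partial_deriv) auto

lemma laplacian_lincomb:
  assumes "\<phi> \<in> test_functions \<Omega>" "\<psi> \<in> test_functions \<Omega>"
  shows "laplacian (\<lambda>x. a * \<phi> x + b * \<psi> x) = (\<lambda>x. a * laplacian \<phi> x + b * laplacian \<psi> x)"
proof -
  have "smooth \<phi>" "smooth \<psi>" using assms by (auto simp: test_functions_def)
  then show ?thesis
    by (simp add: laplacian_def fun_eq_iff partial_deriv_lincomb smooth_differentiable
        smooth_partial_deriv sum.distrib sum_distrib_left)
qed

section \<open>Integration by parts, symmetry and closability of the Laplacian\<close>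

text \<open>Restricting to a coordinate line makes the one-variable difference quotient and the mean
  value theorem available for \<open>partial_deriv\<close>.\<close>

lemma partial_deriv_line:
  fixes h :: "real^'n::finite \<Rightarrow> real"
  assumes "h differentiable_on UNIV"
  shows "((\<lambda>s. h (x + s *\<^sub>R axis i 1)) has_real_derivative
      partial_deriv i h (x + t *\<^sub>R axis i 1)) (at t)"
proof -
  let ?y = "x + t *\<^sub>R axis i 1" and ?D = "frechet_derivative h (at (x + t *\<^sub>R axis i 1))"
  have D: "(h has_derivative ?D) (at ?y)"
    using assms by (auto simp: differentiable_on_def frechet_derivative_works)
  have "((\<lambda>s. x + s *\<^sub>R axis i 1) has_derivative (\<lambda>s. s *\<^sub>R axis i 1)) (at t)"
    by (auto intro!: derivative_eq_intros)
  from has_derivative_compose[OF this D]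
  have "((\<lambda>s. h (x + s *\<^sub>R axis i 1)) has_derivative (\<lambda>s. ?D (s *\<^sub>R axis i 1))) (at t)" .
  moreover have "(\<lambda>s. ?D (s *\<^sub>R axis i 1)) = (*) (partial_deriv i h ?y)"
    using linear_scale[OF has_derivative_linear[OF D]]
    by (auto simp: partial_deriv_def mult.commute)
  ultimately show ?thesis by (simp add: has_field_derivative_def)
qed

lemma integrable_compact_support:
  fixes h :: "real^'n::finite \<Rightarrow> real"
  assumes "continuous_on UNIV h" "compact (closure {x. h x \<noteq> 0})"
  shows "integrable lborel h"
proof -
  let ?S = "closure {x. h x \<noteq> 0}"
  have "integrable lborel (\<lambda>x. indicator ?S x *\<^sub>R h x)"
    by (rule borel_integrable_compact) (use assms continuous_on_subset in blast)+
  also have "(\<lambda>x. indicator ?S x *\<^sub>R h x) = h"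
    using closure_subset[of "{x. h x \<noteq> 0}"] by (auto simp: indicator_def fun_eq_iff)
  finally show ?thesis .
qed

lemma integral_lborel_translation:
  fixes h :: "real^'n::finite \<Rightarrow> real"
  assumes "h \<in> borel_measurable borel"
  shows "(\<integral>x. h (x + c) \<partial>lborel) = (\<integral>x. h x \<partial>lborel)"
    and "integrable lborel h \<Longrightarrow> integrable lborel (\<lambda>x. h (x + c))"
proof -
  have "(\<integral>x. h x \<partial>lborel) = (\<integral>x. h x \<partial>(distr lborel borel ((+) c)))"
    by (simp add: lborel_distr_plus)
  also have "\<dots> = (\<integral>x. h (c + x) \<partial>lborel)"
    using assms by (subst integral_distr) auto
  finally show "(\<integral>x. h (x + c) \<partial>lborel) = (\<integral>x. h x \<partial>lborel)" by (simp add: add.commute)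
  assume "integrable lborel h"
  then have "integrable (distr lborel borel ((+) c)) h" by (simp add: lborel_distr_plus)
  then show "integrable lborel (\<lambda>x. h (x + c))"
    using assms by (subst (asm) integrable_distr_eq) (auto simp: add.commute)
qed

text \<open>Translation invariance makes the integrals of the difference quotients vanish; they converge
  dominatedly to the partial derivative.\<close>

lemma integral_partial_deriv_eq_0:
  fixes h :: "real^'n::finite \<Rightarrow> real"
  assumes diff: "h differentiable_on UNIV"
    and cont: "continuous_on UNIV (partial_deriv i h)"
    and supp: "compact (closure {x. h x \<noteq> 0})"
  shows "(\<integral>x. partial_deriv i h x \<partial>lborel) = 0"
proof -
  define e where "e = (axis i 1 :: real^'n)"
  define s where "s n = 1 / real (Suc n)" for n
  define F where "F n x = (h (x + s n *\<^sub>R e) - h x) / s n" for n x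
  have s: "0 < s n" "s n \<le> 1" for n by (auto simp: s_def)
  have e: "norm e = 1" by (simp add: e_def norm_axis_1)
  have hc: "continuous_on UNIV h" by (rule differentiable_imp_continuous_on[OF diff])
  have hb [measurable]: "h \<in> borel_measurable borel"
    using hc by (rule borel_measurable_continuous_onI)
  have hi: "integrable lborel h" by (rule integrable_compact_support[OF hc supp])
  obtain R where R: "0 < R" "\<And>x. h x \<noteq> 0 \<Longrightarrow> norm x \<le> R"
  proof -
    have "bounded {x. h x \<noteq> 0}"
      using supp by (meson bounded_subset closure_subset compact_imp_bounded)
    then show ?thesis using that by (auto simp: bounded_pos)
  qed
  \<comment> \<open>Shifts have length at most 1, so \<open>F n x\<close> can be nonzero only for
    norm x \<le> R + 1. There the mean value theorem writes it as a partial derivative at a point of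
    norm at most R + 2, which gives the dominating function
    \<open>B * indicator (cball 0 (R + 1))\<close>.\<close>
  have "bounded (partial_deriv i h ` cball 0 (R + 2))"
    by (intro compact_imp_bounded compact_continuous_image continuous_on_subset[OF cont]) auto
  then obtain B where B: "0 < B" "\<And>x. norm x \<le> R + 2 \<Longrightarrow> \<bar>partial_deriv i h x\<bar> \<le> B"
    by (auto simp: bounded_pos)
  have lim: "(\<lambda>n. F n x) \<longlonglongrightarrow> partial_deriv i h x" for x
  proof -
    have "(\<lambda>t. (h (x + t *\<^sub>R e) - h x) / t) \<midarrow>0\<rightarrow> partial_deriv i h x"
      using DERIV_D[OF partial_deriv_line[OF diff, of x i 0]] by (simp add: e_def)
    moreover have "filterlim s (at 0) sequentially"
      unfolding filterlim_at using LIMSEQ_inverse_real_of_nat s(1)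
      by (auto simp: s_def[abs_def] inverse_eq_divide intro!: always_eventually)
    ultimately show ?thesis unfolding F_def by (rule filterlim_compose)
  qed
  have bound: "\<bar>F n x\<bar> \<le> B * indicator (cball 0 (R + 1)) x" for n x
  proof (cases "norm x \<le> R + 1")
    case True
    have "\<exists>z>0. z < s n \<and> h (x + s n *\<^sub>R e) - h (x + 0 *\<^sub>R e)
        = (s n - 0) * partial_deriv i h (x + z *\<^sub>R e)"
      unfolding e_def by (rule MVT2) (use s partial_deriv_line[OF diff] in auto)
    then obtain z where z: "0 < z" "z < s n" "h (x + s n *\<^sub>R e) - h x = s n * partial_deriv i h (x + z *\<^sub>R e)"
      by auto
    have "norm (x + z *\<^sub>R e) \<le> norm x + norm (z *\<^sub>R e)" by (rule norm_triangle_ineq)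
    also have "\<dots> \<le> R + 2" using True z s(2)[of n] e by simp
    finally have "\<bar>partial_deriv i h (x + z *\<^sub>R e)\<bar> \<le> B" by (rule B(2))
    moreover have "F n x = partial_deriv i h (x + z *\<^sub>R e)"
      unfolding F_def z(3) using s(1)[of n] by simp
    ultimately show ?thesis using True by simp
  next
    case False
    have "norm x - norm (s n *\<^sub>R e) \<le> norm (x + s n *\<^sub>R e)" by (rule norm_diff_ineq)
    then have "R < norm (x + s n *\<^sub>R e)" using False s[of n] e by simp
    then have "h (x + s n *\<^sub>R e) = 0" "h x = 0" using R(2) False by fastforce+
    then show ?thesis using B by (simp add: F_def)
  qed
  have "(\<lambda>n. \<integral>x. F n x \<partial>lborel) \<longlonglongrightarrow> (\<integral>x. partial_deriv i h x \<partial>lborel)"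
  proof (rule integral_dominated_convergence)
    show "partial_deriv i h \<in> borel_measurable lborel"
      using borel_measurable_continuous_onI[OF cont] by simp
    show "F n \<in> borel_measurable lborel" for n unfolding F_def[abs_def] by measurable
    show "integrable lborel (\<lambda>x. B * indicator (cball 0 (R + 1)) x :: real)"
      by (intro integrable_mult_right integrable_real_indicator emeasure_bounded_finite) auto
  qed (use lim bound in auto)
  moreover have "(\<integral>x. F n x \<partial>lborel) = 0" for n
    unfolding F_def using integral_lborel_translation[OF hb, of "s n *\<^sub>R e"] hi by simp
  ultimately show ?thesis by (simp add: LIMSEQ_const_iff)
qed

text \<open>What \<open>integral_partial_deriv_eq_0\<close> and the linearity of the integral ask of
  a product.\<close>

lemma test_functions_mult:
  assumes "\<phi> \<in> test_functions \<Omega>" "\<psi> \<in> test_functions \<Omega>"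
  shows "(\<lambda>x. \<phi> x * \<psi> x) differentiable_on UNIV"
    and "compact (closure {x. \<phi> x * \<psi> x \<noteq> 0})"
    and "integrable lborel (\<lambda>x. \<phi> x * \<psi> x)"
proof -
  show d: "(\<lambda>x. \<phi> x * \<psi> x) differentiable_on UNIV"
    using assms by (intro differentiable_on_mult smooth_differentiable) (auto simp: test_functions_def)
  have "bounded {x. \<phi> x \<noteq> 0}"
    using assms(1) by (simp add: test_functions_def)
  then have "bounded {x. \<phi> x * \<psi> x \<noteq> 0}" by (rule bounded_subset) auto
  then show c: "compact (closure {x. \<phi> x * \<psi> x \<noteq> 0})" by (simp only: compact_closure)
  show "integrable lborel (\<lambda>x. \<phi> x * \<psi> x)"
    by (rule integrable_compact_support[OF differentiable_imp_continuous_on[OF d] c])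
qed

text \<open>The product rule applied to \<integral> \<partial>_i (\<phi> \<psi>) = 0; compact
  support leaves no boundary term.\<close>

lemma integral_by_parts:
  assumes \<phi>: "\<phi> \<in> test_functions \<Omega>" and \<psi>: "\<psi> \<in> test_functions \<Omega>"
  shows "(\<integral>x. \<phi> x * partial_deriv i \<psi> x \<partial>lborel) = - (\<integral>x. partial_deriv i \<phi> x * \<psi> x \<partial>lborel)"
proof -
  note m = test_functions_mult
  note \<phi>' = test_functions_partial_deriv[OF \<phi>, of i] and \<psi>' = test_functions_partial_deriv[OF \<psi>, of i]
  have "\<phi> differentiable_on UNIV" "\<psi> differentiable_on UNIV"
    using \<phi> \<psi> by (auto simp: test_functions_def intro: smooth_differentiable)
  then have pd: "partial_deriv i (\<lambda>x. \<phi> x * \<psi> x) = (\<lambda>x. \<phi> x * partial_deriv i \<psi> x + partial_deriv i \<phi> x * \<psi> x)"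
    by (rule partial_deriv_mult)
  have "continuous_on UNIV (partial_deriv i (\<lambda>x. \<phi> x * \<psi> x))"
    unfolding pd using m(1)[OF \<phi> \<psi>'] m(1)[OF \<phi>' \<psi>]
    by (intro continuous_on_add differentiable_imp_continuous_on)
  from integral_partial_deriv_eq_0[OF m(1)[OF \<phi> \<psi>] this m(2)[OF \<phi> \<psi>]]
  show ?thesis unfolding pd using m(3)[OF \<phi> \<psi>'] m(3)[OF \<phi>' \<psi>] by simp
qed

text \<open>Bridge between the measure of the definitions and \<open>lborel\<close>, where
  translation invariance was used: \<phi> vanishes off \<Omega>, and Lebesgue measure is the
  completion of \<open>lborel\<close>.\<close>

lemma integral_lebesgue_on_mult:
  assumes "open \<Omega>" "\<phi> \<in> test_functions \<Omega>" "\<psi> \<in> test_functions \<Omega>"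
  shows "(\<integral>x. \<phi> x * \<psi> x \<partial>lebesgue_on \<Omega>) = (\<integral>x. \<phi> x * \<psi> x \<partial>lborel)"
    and "integrable (lebesgue_on \<Omega>) (\<lambda>x. \<phi> x * \<psi> x)"
proof -
  have \<Omega>: "\<Omega> \<in> sets lebesgue" using assms(1) by (simp add: borel_open)
  have ind: "(\<lambda>x. indicator \<Omega> x *\<^sub>R (\<phi> x * \<psi> x)) = (\<lambda>x. \<phi> x * \<psi> x)"
    using assms(2) closure_subset[of "{x. \<phi> x \<noteq> 0}"]
    by (auto simp: test_functions_def indicator_def fun_eq_iff)
  have i: "integrable lborel (\<lambda>x. \<phi> x * \<psi> x)" using assms by (intro test_functions_mult(3))
  then have b: "(\<lambda>x. \<phi> x * \<psi> x) \<in> borel_measurable lborel" by simp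
  show "(\<integral>x. \<phi> x * \<psi> x \<partial>lebesgue_on \<Omega>) = (\<integral>x. \<phi> x * \<psi> x \<partial>lborel)"
    using \<Omega> by (subst integral_restrict_space) (simp_all only: ind integral_completion[OF b], simp)
  show "integrable (lebesgue_on \<Omega>) (\<lambda>x. \<phi> x * \<psi> x)"
    using \<Omega> i by (subst integrable_restrict_space) (simp_all only: ind integrable_completion[OF b], simp)
qed

lemma test_functions_L2:
  assumes "open \<Omega>" "\<phi> \<in> test_functions \<Omega>"
  shows "\<phi> \<in> L2 \<Omega>"
proof -
  have "continuous_on UNIV \<phi>" using assms by (auto simp: test_functions_def intro: smooth_continuous)
  then have "\<phi> \<in> borel_measurable (lebesgue_on \<Omega>)"
    by (intro measurable_restrict_space1 measurable_completion)
      (simp add: borel_measurable_continuous_onI)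
  then show ?thesis
    using integral_lebesgue_on_mult(2)[OF assms assms(2)] by (simp add: L2_def power2_eq_square)
qed

text \<open>Two integrations by parts in each coordinate; their signs cancel.\<close>

lemma laplacian_symmetric:
  assumes "open \<Omega>" and \<phi>: "\<phi> \<in> test_functions \<Omega>" and \<psi>: "\<psi> \<in> test_functions \<Omega>"
  shows "(\<integral>x. laplacian \<phi> x * \<psi> x \<partial>lebesgue_on \<Omega>) = (\<integral>x. \<phi> x * laplacian \<psi> x \<partial>lebesgue_on \<Omega>)"
proof -
  note pd = test_functions_partial_deriv
  have *: "(\<integral>x. partial_deriv i (partial_deriv i \<phi>) x * \<psi> x \<partial>lborel)
      = (\<integral>x. \<phi> x * partial_deriv i (partial_deriv i \<psi>) x \<partial>lborel)" for i
    using integral_by_parts[OF pd[OF \<phi>] \<psi>, of i i] integral_by_parts[OF \<phi> pd[OF \<psi>], of i i]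
    by simp
  have "(\<integral>x. laplacian \<phi> x * \<psi> x \<partial>lborel)
      = (\<Sum>i\<in>UNIV. \<integral>x. partial_deriv i (partial_deriv i \<phi>) x * \<psi> x \<partial>lborel)"
    unfolding laplacian_def sum_distrib_right
    by (intro Bochner_Integration.integral_sum test_functions_mult(3)[where \<Omega> = \<Omega>] pd \<phi> \<psi>)
  also have "\<dots> = (\<Sum>i\<in>UNIV. \<integral>x. \<phi> x * partial_deriv i (partial_deriv i \<psi>) x \<partial>lborel)"
    by (simp add: *)
  also have "\<dots> = (\<integral>x. \<phi> x * laplacian \<psi> x \<partial>lborel)"
    unfolding laplacian_def sum_distrib_left
    by (intro Bochner_Integration.integral_sum[symmetric] test_functions_mult(3)[where \<Omega> = \<Omega>] pd \<phi> \<psi>)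
  finally show ?thesis
    by (simp add: integral_lebesgue_on_mult(1)[OF \<open>open \<Omega>\<close>] test_functions_laplacian \<phi> \<psi>)
qed

text \<open>The Laplacian is closable on test functions: if \<open>\<theta>\<^sub>n \<rightarrow> 0\<close> and \<open>\<Delta>\<theta>\<^sub>n \<rightarrow> w\<close> in \<open>L\<^sup>2\<close>, then
  \<open>\<integral> w \<Delta>\<theta>\<^sub>m = lim \<integral> \<theta>\<^sub>n \<Delta>\<^sup>2\<theta>\<^sub>m = 0\<close> for each \<open>m\<close>, and \<open>m \<rightarrow> \<infinity>\<close> gives \<open>\<integral> w\<^sup>2 = 0\<close>.\<close>

lemma laplacian_closable:
  assumes \<Omega>: "open \<Omega>" and \<theta>: "\<And>n. \<theta> n \<in> test_functions \<Omega>" and w: "w \<in> L2 \<Omega>"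
    and lim0: "(\<lambda>n. L2_norm \<Omega> (\<theta> n)) \<longlonglongrightarrow> 0"
    and limw: "(\<lambda>n. L2_norm \<Omega> (\<lambda>x. laplacian (\<theta> n) x - w x)) \<longlonglongrightarrow> 0"
  shows "AE x in lebesgue_on \<Omega>. w x = 0"
proof -
  let ?I = "\<lambda>f g. \<integral>x. f x * g x \<partial>lebesgue_on \<Omega>"
  let ?d = "\<lambda>n. L2_norm \<Omega> (\<lambda>x. laplacian (\<theta> n) x - w x)"
  note T = test_functions_laplacian test_functions_L2[OF \<Omega>]
  have L: "\<theta> n \<in> L2 \<Omega>" "laplacian (\<theta> n) \<in> L2 \<Omega>" "laplacian (laplacian (\<theta> n)) \<in> L2 \<Omega>" for n
    by (intro T \<theta>)+
  have close: "\<bar>?I (laplacian (\<theta> n)) g - ?I w g\<bar> \<le> ?d n * L2_norm \<Omega> g" if g: "g \<in> L2 \<Omega>" for n g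
  proof -
    have "?I (laplacian (\<theta> n)) g - ?I w g = (\<integral>x. (laplacian (\<theta> n) x - w x) * g x \<partial>lebesgue_on \<Omega>)"
      using L2_mult_integrable[OF L(2) g] L2_mult_integrable[OF w g]
      by (simp add: left_diff_distrib)
    then show ?thesis using L2_Cauchy_Schwarz[OF L2_diff[OF L(2) w] g] by simp
  qed
  \<comment> \<open>Norm convergence implies weak convergence. It is used with
    \<open>g = laplacian (\<theta> m)\<close> and then with \<open>g = w\<close>.\<close>
  have lim: "(\<lambda>n. ?I (laplacian (\<theta> n)) g) \<longlonglongrightarrow> ?I w g" if g: "g \<in> L2 \<Omega>" for g
  proof -
    have "(\<lambda>n. ?d n * L2_norm \<Omega> g) \<longlonglongrightarrow> 0"
      using tendsto_mult_left_zero[OF limw] .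
    then have "(\<lambda>n. ?I (laplacian (\<theta> n)) g - ?I w g) \<longlonglongrightarrow> 0"
      by (rule Lim_null_comparison[rotated]) (simp add: close[OF g])
    then show ?thesis by (simp add: LIM_zero_iff)
  qed
  have "?I w (laplacian (\<theta> m)) = 0" for m
  proof -
    have "\<bar>?I (laplacian (\<theta> n)) (laplacian (\<theta> m))\<bar>
        \<le> L2_norm \<Omega> (\<theta> n) * L2_norm \<Omega> (laplacian (laplacian (\<theta> m)))" for n
      using L2_Cauchy_Schwarz[OF L(1)[of n] L(3)[of m]]
      by (simp add: laplacian_symmetric[OF \<Omega> \<theta> test_functions_laplacian[OF \<theta>]])
    then have "(\<lambda>n. ?I (laplacian (\<theta> n)) (laplacian (\<theta> m))) \<longlonglongrightarrow> 0"
      by (intro Lim_null_comparison[OF always_eventually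
            tendsto_mult_left_zero[OF lim0, of "L2_norm \<Omega> (laplacian (laplacian (\<theta> m)))"]]) simp
    then show ?thesis using lim[OF L(2)] LIMSEQ_unique by blast
  qed
  then have "(\<lambda>m. ?I (laplacian (\<theta> m)) w) \<longlonglongrightarrow> 0" by (simp add: mult.commute)
  then have "?I w w = 0" using lim[OF w] LIMSEQ_unique by blast
  then have "L2_norm \<Omega> w = 0" by (simp add: L2_norm_def power2_eq_square)
  then show ?thesis by (rule L2_norm_eq_0_AE[OF w])
qed

section \<open>The Laplacian on \<open>H02\<close>: uniqueness and homogeneity\<close>

text \<open>The predicate under the choice operator in \<open>H02_laplacian\<close>, isolated so
  that existence, uniqueness and scaling can be treated apart from the choice.\<close>

definition strong_laplacian :: "(real^'n::finite) set \<Rightarrow> (real^'n \<Rightarrow> real) \<Rightarrow> (real^'n \<Rightarrow> real) \<Rightarrow> bool" where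
  "strong_laplacian \<Omega> u w \<longleftrightarrow> w \<in> L2 \<Omega> \<and>
     (\<exists>\<phi>. H02_approx \<Omega> \<phi> u \<and> (\<lambda>n. L2_norm \<Omega> (\<lambda>x. laplacian (\<phi> n) x - w x)) \<longlonglongrightarrow> 0)"

lemma H02_laplacian_eq: "H02_laplacian \<Omega> u = (SOME w. strong_laplacian \<Omega> u w)"
  by (simp add: H02_laplacian_def strong_laplacian_def)

text \<open>The difference of the two approximating sequences tends to 0 in \<open>L2\<close> while
  its Laplacians tend to \<open>w - w'\<close>, so closability applies.\<close>

lemma strong_laplacian_unique:
  assumes \<Omega>: "open \<Omega>" and u: "u \<in> L2 \<Omega>"
    and "strong_laplacian \<Omega> u w" "strong_laplacian \<Omega> u w'"
  shows "AE x in lebesgue_on \<Omega>. w x = w' x"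
proof -
  obtain \<phi> \<psi> where w: "w \<in> L2 \<Omega>" "w' \<in> L2 \<Omega>"
    and ap: "H02_approx \<Omega> \<phi> u" "H02_approx \<Omega> \<psi> u"
    and limw: "(\<lambda>n. L2_norm \<Omega> (\<lambda>x. laplacian (\<phi> n) x - w x)) \<longlonglongrightarrow> 0"
      "(\<lambda>n. L2_norm \<Omega> (\<lambda>x. laplacian (\<psi> n) x - w' x)) \<longlonglongrightarrow> 0"
    using assms(3,4) unfolding strong_laplacian_def by blast
  have T: "\<phi> n \<in> test_functions \<Omega>" "\<psi> n \<in> test_functions \<Omega>" for n
    using ap by (auto simp: H02_approx_def)
  have limu: "(\<lambda>n. L2_norm \<Omega> (\<lambda>x. \<phi> n x - u x)) \<longlonglongrightarrow> 0" "(\<lambda>n. L2_norm \<Omega> (\<lambda>x. \<psi> n x - u x)) \<longlonglongrightarrow> 0"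
    using ap by (auto simp: H02_approx_def)
  define \<theta> where "\<theta> n x = \<phi> n x - \<psi> n x" for n x
  have \<theta>: "\<theta> n \<in> test_functions \<Omega>" for n
    using test_functions_lincomb[OF T[of n], of 1 "-1"] by (simp add: \<theta>_def[abs_def])
  have lap: "laplacian (\<theta> n) = (\<lambda>x. laplacian (\<phi> n) x - laplacian (\<psi> n) x)" for n
    using laplacian_lincomb[OF T[of n], of 1 "-1"] by (simp add: \<theta>_def[abs_def])
  \<comment> \<open>Applied to the errors of \<open>\<phi> n\<close> and \<open>\<psi> n\<close>,
    where \<open>u\<close> cancels in the difference, and to the errors of their Laplacians, where
    \<open>w - w'\<close> remains.\<close>
  have diff0: "(\<lambda>n. L2_norm \<Omega> (\<lambda>x. f n x - g n x)) \<longlonglongrightarrow> 0"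
    if "\<And>n. f n \<in> L2 \<Omega>" "\<And>n. g n \<in> L2 \<Omega>"
      "(\<lambda>n. L2_norm \<Omega> (f n)) \<longlonglongrightarrow> 0" "(\<lambda>n. L2_norm \<Omega> (g n)) \<longlonglongrightarrow> 0" for f g
    by (rule Lim_null_comparison[OF always_eventually tendsto_add_zero[OF that(3,4)]])
      (simp add: L2_norm_nonneg L2_norm_triangle_diff that(1,2))
  note TL = test_functions_L2[OF \<Omega>]
  have "(\<lambda>n. L2_norm \<Omega> (\<theta> n)) \<longlonglongrightarrow> 0"
    using diff0[OF _ _ limu] L2_diff[OF TL[OF T(1)] u] L2_diff[OF TL[OF T(2)] u]
    by (simp add: \<theta>_def[abs_def])
  moreover have "(\<lambda>n. L2_norm \<Omega> (\<lambda>x. laplacian (\<theta> n) x - (w x - w' x))) \<longlonglongrightarrow> 0"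
    using diff0[OF _ _ limw] L2_diff[OF TL[OF test_functions_laplacian[OF T(1)]] w(1)]
      L2_diff[OF TL[OF test_functions_laplacian[OF T(2)]] w(2)]
    by (simp add: lap algebra_simps)
  ultimately have "AE x in lebesgue_on \<Omega>. w x - w' x = 0"
    by (rule laplacian_closable[OF \<Omega> \<theta> L2_diff[OF w]])
  then show ?thesis by simp
qed

lemma H02_approx_scale:
  assumes "H02_approx \<Omega> \<phi> u"
  shows "H02_approx \<Omega> (\<lambda>n x. c * \<phi> n x) (\<lambda>x. c * u x)"
    and "laplacian (\<lambda>x. c * \<phi> n x) = (\<lambda>x. c * laplacian (\<phi> n) x)"
proof -
  have T: "\<phi> n \<in> test_functions \<Omega>" for n using assms by (auto simp: H02_approx_def)
  show lap: "laplacian (\<lambda>x. c * \<phi> n x) = (\<lambda>x. c * laplacian (\<phi> n) x)" for n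
    using laplacian_lincomb[OF T[of n] T[of n], of c 0] by simp
  have cT: "(\<lambda>x. c * \<phi> n x) \<in> test_functions \<Omega>" for n
    using test_functions_lincomb[OF T[of n] T[of n], of c 0] by simp
  have lapd: "laplacian (\<lambda>x. c * \<phi> m x - c * \<phi> n x) = (\<lambda>x. c * laplacian (\<lambda>x. \<phi> m x - \<phi> n x) x)" for m n
    using laplacian_lincomb[OF T[of m] T[of n], of c "-c"] laplacian_lincomb[OF T[of m] T[of n], of 1 "-1"]
    by (simp add: right_diff_distrib)
  have "\<exists>N. \<forall>m\<ge>N. \<forall>n\<ge>N. L2_norm \<Omega> (laplacian (\<lambda>x. c * \<phi> m x - c * \<phi> n x)) < e" if e: "e > 0" for e
  proof -
    \<comment> \<open>Adding 1 to the denominator covers \<open>c = 0\<close> as well.\<close>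
    have "0 < e / (\<bar>c\<bar> + 1)" using e by simp
    then obtain N where N: "\<And>m n. m \<ge> N \<Longrightarrow> n \<ge> N \<Longrightarrow>
        L2_norm \<Omega> (laplacian (\<lambda>x. \<phi> m x - \<phi> n x)) < e / (\<bar>c\<bar> + 1)"
      using assms unfolding H02_approx_def by meson
    have "L2_norm \<Omega> (laplacian (\<lambda>x. c * \<phi> m x - c * \<phi> n x)) < e" if "m \<ge> N" "n \<ge> N" for m n
    proof -
      have "\<bar>c\<bar> * L2_norm \<Omega> (laplacian (\<lambda>x. \<phi> m x - \<phi> n x))
          \<le> (\<bar>c\<bar> + 1) * L2_norm \<Omega> (laplacian (\<lambda>x. \<phi> m x - \<phi> n x))"
        by (intro mult_right_mono L2_norm_nonneg) simp
      also have "\<dots> < e" using N[OF that] by (simp add: pos_less_divide_eq mult.commute)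
      finally show ?thesis by (simp only: lapd L2_norm_scale)
    qed
    then show ?thesis by blast
  qed
  moreover have "(\<lambda>n. L2_norm \<Omega> (\<lambda>x. c * \<phi> n x - c * u x)) \<longlonglongrightarrow> 0"
    using assms by (auto simp: H02_approx_def right_diff_distrib[symmetric] L2_norm_scale
        intro!: tendsto_mult_right_zero)
  ultimately show "H02_approx \<Omega> (\<lambda>n x. c * \<phi> n x) (\<lambda>x. c * u x)"
    using cT by (simp add: H02_approx_def)
qed

lemma H02_scale: "u \<in> H02 \<Omega> \<Longrightarrow> (\<lambda>x. c * u x) \<in> H02 \<Omega>"
  unfolding H02_def using H02_approx_scale(1)[of \<Omega> _ u c] L2_scale[of u \<Omega> c] by blast

lemma strong_laplacian_scale:
  assumes "strong_laplacian \<Omega> u w"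
  shows "strong_laplacian \<Omega> (\<lambda>x. c * u x) (\<lambda>x. c * w x)"
proof -
  obtain \<phi> where \<phi>: "w \<in> L2 \<Omega>" "H02_approx \<Omega> \<phi> u"
    "(\<lambda>n. L2_norm \<Omega> (\<lambda>x. laplacian (\<phi> n) x - w x)) \<longlonglongrightarrow> 0"
    using assms unfolding strong_laplacian_def by blast
  have "(\<lambda>n. L2_norm \<Omega> (\<lambda>x. laplacian (\<lambda>x. c * \<phi> n x) x - c * w x)) \<longlonglongrightarrow> 0"
    using tendsto_mult_right_zero[OF \<phi>(3), of "\<bar>c\<bar>"]
    by (simp add: H02_approx_scale(2)[OF \<phi>(2)] right_diff_distrib[symmetric] L2_norm_scale)
  then show ?thesis
    using H02_approx_scale(1)[OF \<phi>(2)] L2_scale[OF \<phi>(1)] unfolding strong_laplacian_def by blast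
qed

text \<open>If no strong Laplacian existed, \<open>SOME\<close> would select the same junk function for \<open>u\<close> and for
  \<open>c u\<close>; the inequality is true in that case as well, which avoids an appeal to the completeness
  of \<open>L\<^sup>2\<close>.\<close>

lemma H02_norm_scale_le:
  assumes \<Omega>: "open \<Omega>" and u: "u \<in> L2 \<Omega>" and c: "1 \<le> c"
  shows "H02_norm \<Omega> (\<lambda>x. c * u x) \<le> c * H02_norm \<Omega> u"
proof (cases "\<exists>w. strong_laplacian \<Omega> u w")
  case True
  let ?w = "H02_laplacian \<Omega> u" and ?w' = "H02_laplacian \<Omega> (\<lambda>x. c * u x)"
  have w: "strong_laplacian \<Omega> u ?w"
    unfolding H02_laplacian_eq using True by (rule someI_ex)
  note cw = strong_laplacian_scale[OF w, of c]
  then have w': "strong_laplacian \<Omega> (\<lambda>x. c * u x) ?w'"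
    unfolding H02_laplacian_eq[of \<Omega> "\<lambda>x. c * u x"]
    by (rule someI[of "strong_laplacian \<Omega> (\<lambda>x. c * u x)"])
  \<comment> \<open>The choices for \<open>u\<close> and for \<open>c * u\<close> are made
    independently. Uniqueness equates \<open>?w'\<close> with \<open>c * ?w\<close> only almost
    everywhere, which is enough for the norms.\<close>
  have "L2_norm \<Omega> ?w' = L2_norm \<Omega> (\<lambda>x. c * ?w x)"
    by (rule L2_norm_cong_AE[OF _ _ strong_laplacian_unique[OF \<Omega> L2_scale[OF u] w' cw]])
      (use w' cw in \<open>simp_all add: strong_laplacian_def\<close>)
  then show ?thesis using c by (simp add: H02_norm_def L2_norm_scale)
next
  case False
  \<comment> \<open>Scaling back by \<open>1 / c\<close> would give \<open>u\<close> a strong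
    Laplacian. Hence both predicates are identically false, thus equal, and the choice operator
    returns the same function for both.\<close>
  have False': "\<not> strong_laplacian \<Omega> (\<lambda>x. c * u x) w" for w
    using strong_laplacian_scale[of \<Omega> "\<lambda>x. c * u x" w "1 / c"] False c by auto
  have "strong_laplacian \<Omega> (\<lambda>x. c * u x) = strong_laplacian \<Omega> u"
    using False False' by (intro ext) blast
  then have "H02_laplacian \<Omega> (\<lambda>x. c * u x) = H02_laplacian \<Omega> u"
    by (simp only: H02_laplacian_eq)
  \<comment> \<open>With equal choices the norm does not change under scaling; this case is the
    reason for an inequality restricted to \<open>1 \<le> c\<close>.\<close>
  moreover have "1 * H02_norm \<Omega> u \<le> c * H02_norm \<Omega> u"
    by (rule mult_right_mono[OF c]) (simp add: H02_norm_def L2_norm_nonneg)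
  ultimately show ?thesis by (simp add: H02_norm_def)
qed

section \<open>The first eigenvalue and the coefficient inequality\<close>

text \<open>The Rayleigh quotient bound, multiplied out so that it also covers functions of norm
  zero, for which the left side is 0.\<close>

lemma lambda1_le:
  assumes "u \<in> H02 \<Omega>"
  shows "lambda1 \<Omega> * (L2_norm \<Omega> u)\<^sup>2 \<le> (H02_norm \<Omega> u)\<^sup>2"
proof (cases "L2_norm \<Omega> u = 0")
  case False
  have "\<not> (AE x in lebesgue_on \<Omega>. u x = 0)"
  proof
    assume "AE x in lebesgue_on \<Omega>. u x = 0"
    then have "(\<integral>x. (u x)\<^sup>2 \<partial>lebesgue_on \<Omega>) = 0" by (intro integral_eq_zero_AE) auto
    then show False using False by (simp add: L2_norm_def)
  qed
  then have "lambda1 \<Omega> \<le> (H02_norm \<Omega> u)\<^sup>2 / (L2_norm \<Omega> u)\<^sup>2"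
    unfolding lambda1_def using assms by (intro cINF_lower bdd_belowI2[of _ 0]) auto
  then show ?thesis using False by (simp add: pos_le_divide_eq)
qed simp

text \<open>With \<open>S = q - 1\<close>, the condition \<open>a\<^sub>i \<le> \<lambda> a\<^bsub>i-1\<^esub>\<close> gives \<open>S t \<le> a\<^sub>1 t + \<lambda> t S t\<close>, hence
  \<open>q t (1 - \<alpha> t) \<le> 1 + t (a\<^sub>1 - \<alpha> + (\<lambda> - \<alpha>) S(1 / \<lambda>))\<close>; the value of \<open>\<alpha>\<close> makes the bracket vanish.\<close>

lemma polynomial_le_inverse:
  fixes a :: "nat \<Rightarrow> real" and l :: real
  assumes k: "k \<ge> 1" and a1: "0 \<le> a 1" "a 1 < l"
    and ai: "\<And>i. 2 \<le> i \<Longrightarrow> i \<le> k \<Longrightarrow> 0 \<le> a i \<and> a i \<le> l * a (i - 1)"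
  obtains \<alpha> where "0 \<le> \<alpha>" "\<alpha> < l"
    "\<And>t. 0 \<le> t \<Longrightarrow> l * t \<le> 1 \<Longrightarrow> (1 + (\<Sum>i=1..k. a i * t ^ i)) * (1 - \<alpha> * t) \<le> 1"
proof
  define S where "S t = (\<Sum>i=1..k. a i * t ^ i)" for t
  \<comment> \<open>\<open>S\<close> has nonnegative coefficients and t \<le> 1 / l, so
    \<open>M\<close> bounds \<open>S t\<close> on the whole range. The value \<open>\<alpha>\<close>
    is the average of \<open>a 1\<close> and \<open>l\<close> with weights 1 and \<open>M\<close>,
    hence nonnegative and below \<open>l\<close>; it solves the equation
    \<open>root\<close>.\<close>
  define M where "M = S (1 / l)"
  define \<alpha> where "\<alpha> = (a 1 + l * M) / (1 + M)"
  have l: "0 < l" using a1 by simp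
  have a0: "0 \<le> a i" if "1 \<le> i" "i \<le> k" for i
    using that ai[of i] a1 by (cases "i = 1") auto
  have S0: "0 \<le> S t" if "0 \<le> t" for t
    unfolding S_def using a0 that by (intro sum_nonneg) auto
  have M: "0 \<le> M" unfolding M_def using l by (intro S0) simp
  show "0 \<le> \<alpha>" using M a1 l by (simp add: \<alpha>_def)
  show \<alpha>: "\<alpha> < l" using M a1 by (simp add: \<alpha>_def pos_divide_less_eq algebra_simps)
  have root: "a 1 - \<alpha> + (l - \<alpha>) * M = 0" using M by (simp add: \<alpha>_def field_simps)
  fix t :: real
  assume t: "0 \<le> t" "l * t \<le> 1"
  have "S t = a 1 * t + (\<Sum>i=2..k. a i * t ^ i)"
    unfolding S_def using k by (subst sum.atLeast_Suc_atMost) (auto simp: numeral_2_eq_2)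
  also have "(\<Sum>i=2..k. a i * t ^ i) \<le> (\<Sum>i=2..k. l * t * (a (i - 1) * t ^ (i - 1)))"
  proof (rule sum_mono)
    fix i assume i: "i \<in> {2..k}"
    then have "a i * t ^ i \<le> (l * a (i - 1)) * t ^ i" using ai t by (intro mult_right_mono) auto
    also have "\<dots> = l * a (i - 1) * (t * t ^ (i - 1))" using i by (cases i) auto
    finally show "a i * t ^ i \<le> l * t * (a (i - 1) * t ^ (i - 1))" by (simp add: mult_ac)
  qed
  also have "\<dots> = l * t * (\<Sum>i=1..k-1. a i * t ^ i)"
    unfolding sum_distrib_left
    by (rule sum.reindex_bij_witness[of _ Suc "\<lambda>i. i - 1"]) auto
  \<comment> \<open>The index shift produced \<open>S t\<close> without its top term, which is
    nonnegative.\<close>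
  also have "\<dots> \<le> l * t * S t"
    unfolding S_def using a0 t l by (intro mult_left_mono sum_mono2) auto
  finally have rec: "S t \<le> a 1 * t + l * t * S t" by simp
  have "S t \<le> M"
    unfolding S_def M_def using t l a0
    by (intro sum_mono mult_left_mono power_mono) (auto simp: field_simps)
  then have "(l - \<alpha>) * S t \<le> (l - \<alpha>) * M" using \<alpha> by (intro mult_left_mono) auto
  then have "a 1 - \<alpha> + (l - \<alpha>) * S t \<le> 0" using root by simp
  then have "t * (a 1 - \<alpha> + (l - \<alpha>) * S t) \<le> 0" using t by (simp add: mult_nonneg_nonpos)
  moreover have "(1 + S t) * (1 - \<alpha> * t) \<le> 1 + t * (a 1 - \<alpha> + (l - \<alpha>) * S t)"
    using rec by (simp add: algebra_simps)
  ultimately show "(1 + (\<Sum>i=1..k. a i * t ^ i)) * (1 - \<alpha> * t) \<le> 1"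
    unfolding S_def by linarith
qed

section \<open>Comparison of the two suprema by scaling each function\<close>

theorem proposition1p2:
  fixes \<Omega> :: "(real^4) set" and k :: nat and a :: "nat \<Rightarrow> real" and q :: "real \<Rightarrow> real"
  assumes "smooth_bounded_domain \<Omega>"
    and "\<And>\<alpha>. 0 \<le> \<alpha> \<Longrightarrow> \<alpha> < lambda1 \<Omega> \<Longrightarrow>
      (SUP u\<in>{u \<in> H02 \<Omega>. H02_norm_alpha \<Omega> \<alpha> u \<le> 1}.
         \<integral>\<^sup>+x. ennreal (exp (32 * pi\<^sup>2 * (u x)\<^sup>2)) \<partial>lebesgue_on \<Omega>) < \<infinity>"
    and "k \<ge> 1"
    and "0 \<le> a 1" and "a 1 < lambda1 \<Omega>"
    and "\<And>i. 2 \<le> i \<Longrightarrow> i \<le> k \<Longrightarrow> 0 \<le> a i \<and> a i \<le> lambda1 \<Omega> * a (i - 1)"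
    and "\<And>t. q t = 1 + (\<Sum>i=1..k. a i * t ^ i)"
  shows "(SUP u\<in>{u \<in> H02 \<Omega>. H02_norm \<Omega> u \<le> 1}.
         \<integral>\<^sup>+x. ennreal (exp (32 * pi\<^sup>2 * q ((L2_norm \<Omega> u)\<^sup>2) * (u x)\<^sup>2)) \<partial>lebesgue_on \<Omega>) < \<infinity>"
proof -
  have \<Omega>: "open \<Omega>" using assms(1) by (simp add: smooth_bounded_domain_def)
  obtain \<alpha> where \<alpha>: "0 \<le> \<alpha>" "\<alpha> < lambda1 \<Omega>"
    and q\<alpha>: "\<And>t. 0 \<le> t \<Longrightarrow> lambda1 \<Omega> * t \<le> 1 \<Longrightarrow> q t * (1 - \<alpha> * t) \<le> 1"
    using polynomial_le_inverse[of k a "lambda1 \<Omega>"] assms(3-7) by auto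
  \<comment> \<open>This makes the scaling factor \<open>c\<close> below at least 1, as
    \<open>H02_norm_scale_le\<close> requires.\<close>
  have q1: "1 \<le> q t" if "0 \<le> t" for t
  proof -
    have "0 \<le> a i" if "i \<in> {1..k}" for i
      using that assms(4) assms(6)[of i] by (cases "i = 1") auto
    then have "0 \<le> (\<Sum>i=1..k. a i * t ^ i)" using \<open>0 \<le> t\<close> by (intro sum_nonneg) auto
    then show ?thesis by (simp add: assms(7))
  qed
  have "(SUP u\<in>{u \<in> H02 \<Omega>. H02_norm \<Omega> u \<le> 1}.
         \<integral>\<^sup>+x. ennreal (exp (32 * pi\<^sup>2 * q ((L2_norm \<Omega> u)\<^sup>2) * (u x)\<^sup>2)) \<partial>lebesgue_on \<Omega>)
      \<le> (SUP u\<in>{u \<in> H02 \<Omega>. H02_norm_alpha \<Omega> \<alpha> u \<le> 1}.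
         \<integral>\<^sup>+x. ennreal (exp (32 * pi\<^sup>2 * (u x)\<^sup>2)) \<partial>lebesgue_on \<Omega>)"
  \<comment> \<open>The factor \<open>c\<close> varies with \<open>u\<close>, but
    \<open>\<alpha>\<close> is already fixed, so a single supremum from the hypothesis dominates all
    the integrals.\<close>
  proof (rule SUP_mono)
    fix u
    assume "u \<in> {u \<in> H02 \<Omega>. H02_norm \<Omega> u \<le> 1}"
    then have u: "u \<in> H02 \<Omega>" "H02_norm \<Omega> u \<le> 1" by auto
    define t where "t = (L2_norm \<Omega> u)\<^sup>2"
    define c where "c = sqrt (q t)"
    let ?v = "\<lambda>x. c * u x"
    have N0: "0 \<le> H02_norm \<Omega> f" for f by (simp add: H02_norm_def L2_norm_nonneg)
    have t: "0 \<le> t" by (simp add: t_def)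
    have c: "1 \<le> c" "c\<^sup>2 = q t" using q1[OF t] by (auto simp: c_def)
    have sq1: "(H02_norm \<Omega> u)\<^sup>2 \<le> 1" using u(2) N0 by (simp add: power_le_one)
    then have lt: "lambda1 \<Omega> * t \<le> 1" using lambda1_le[OF u(1)] by (simp add: t_def)
    have "H02_norm \<Omega> ?v \<le> c * H02_norm \<Omega> u"
      using u(1) c(1) by (intro H02_norm_scale_le[OF \<Omega>]) (auto simp: H02_def)
    then have "(H02_norm \<Omega> ?v)\<^sup>2 \<le> (c * H02_norm \<Omega> u)\<^sup>2" using N0 by (intro power_mono)
    also have "\<dots> = q t * (H02_norm \<Omega> u)\<^sup>2" by (simp add: power_mult_distrib c)
    \<comment> \<open>Only the Laplacian term is replaced by its bound 1. The term in
      \<open>t\<close> is kept exactly, so that the product estimated by \<open>q\<alpha>\<close>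
      appears.\<close>
    also have "\<dots> \<le> q t * 1" using sq1 q1[OF t] by (intro mult_left_mono) auto
    finally have "(H02_norm \<Omega> ?v)\<^sup>2 - \<alpha> * (L2_norm \<Omega> ?v)\<^sup>2 \<le> q t * (1 - \<alpha> * t)"
      by (simp add: L2_norm_scale power_mult_distrib c t_def[symmetric] algebra_simps)
    also have "\<dots> \<le> 1" by (rule q\<alpha>[OF t lt])
    \<comment> \<open>\<open>sqrt\<close> is odd and monotone on all reals, so the bound passes
      through it whatever the sign of the difference.\<close>
    finally have "H02_norm_alpha \<Omega> \<alpha> ?v \<le> 1" by (simp add: H02_norm_alpha_def)
    moreover have "(\<lambda>x. ennreal (exp (32 * pi\<^sup>2 * q ((L2_norm \<Omega> u)\<^sup>2) * (u x)\<^sup>2)))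
        = (\<lambda>x. ennreal (exp (32 * pi\<^sup>2 * (?v x)\<^sup>2)))"
      by (simp add: power_mult_distrib c t_def[symmetric] mult.assoc)
    ultimately show "\<exists>v\<in>{u \<in> H02 \<Omega>. H02_norm_alpha \<Omega> \<alpha> u \<le> 1}.
        (\<integral>\<^sup>+x. ennreal (exp (32 * pi\<^sup>2 * q ((L2_norm \<Omega> u)\<^sup>2) * (u x)\<^sup>2)) \<partial>lebesgue_on \<Omega>)
        \<le> (\<integral>\<^sup>+x. ennreal (exp (32 * pi\<^sup>2 * (v x)\<^sup>2)) \<partial>lebesgue_on \<Omega>)"
      using H02_scale[OF u(1), of c] by (intro bexI[of _ ?v]) auto
  qed
  also have "\<dots> < \<infinity>" by (rule assms(2)[OF \<alpha>])
  finally show ?thesis .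
qed

end
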